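(* Let $\mathcal{G}$ be a temporal graph whose underlying graph is a tree. Suppose a root $r$ can be chosen such that, for every vertex $v$, the edges incident to $v$ are active strictly before all other edges in the subtree rooted at $v$. Then the $\geq$-connected-VIM width of $\mathcal{G}$ is $\max_t\max_v\deg_{G'_t}(v)+1$, where $G'_t$ is the snapshot at time $t$ of the temporal graph $\mathcal{G}'$ obtained from $\mathcal{G}$ by adding the time-edge $(uv,t)$ for all vertices $u,v$ and times $t$ for which there exist times $t_1<t<t_2$ with $(uv,t_1)$ and $(uv,t_2)$ time-edges of $\mathcal{G}$.
   Context: A temporal graph $\mathcal{G}=(G,\lambda)$: static (underlying) graph $G=(V,E)$ and $\lambda:E\to 2^{\mathbb{N}}$; time-edges $(e,t)$ with $t\in\lambda(e)$; snapshot $G_t=(V,\{e:t\in\lambda(e)\})$; lifetime $\Lambda=\max_e\max\lambda(e)$. VIM sequence: $F_t=\{v:\exists u,w,\ \min\lambda(vu)\le t\le\max\lambda(vw)\}$ for $t\in[\Lambda]$. $G_{\ge}(t)$ is the static graph on $V$ whose edges are those having a time-edge at time $\ge t$. The $\geq$-connected-VIM width is $\max\{|V(C)\cap F_t|: t\in[\Lambda],\ C \text{ a connected component of } G_{\ge}(t)\}$. *)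

theory Defs
  imports Main
begin

record 'a sgraph =
  verts :: "'a set"
  edges :: "'a set set"

definition simple_graph :: "('a, 'b) sgraph_scheme \<Rightarrow> bool" where
  "simple_graph G \<longleftrightarrow> finite (verts G) \<and>
     (\<forall>e \<in> edges G. \<exists>u \<in> verts G. \<exists>v \<in> verts G. u \<noteq> v \<and> e = {u, v})"

definition walk :: "('a, 'b) sgraph_scheme \<Rightarrow> 'a list \<Rightarrow> bool" where
  "walk G p \<longleftrightarrow> p \<noteq> [] \<and> set p \<subseteq> verts G \<and> successively (\<lambda>u v. {u, v} \<in> edges G) p"

definition path_between :: "('a, 'b) sgraph_scheme \<Rightarrow> 'a \<Rightarrow> 'a list \<Rightarrow> 'a \<Rightarrow> bool" where
  "path_between G u p v \<longleftrightarrow> walk G p \<and> distinct p \<and> hd p = u \<and> last p = v"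

definition connected_graph :: "('a, 'b) sgraph_scheme \<Rightarrow> bool" where
  "connected_graph G \<longleftrightarrow> verts G \<noteq> {} \<and>
     (\<forall>u \<in> verts G. \<forall>v \<in> verts G. \<exists>p. path_between G u p v)"

definition cycle :: "('a, 'b) sgraph_scheme \<Rightarrow> 'a list \<Rightarrow> bool" where
  "cycle G p \<longleftrightarrow> walk G p \<and> distinct p \<and> 3 \<le> length p \<and> {last p, hd p} \<in> edges G"

definition tree :: "('a, 'b) sgraph_scheme \<Rightarrow> bool" where
  "tree G \<longleftrightarrow> simple_graph G \<and> connected_graph G \<and> (\<nexists>p. cycle G p)"

text \<open>Connected components, represented by their vertex sets.\<close>

definition components :: "('a, 'b) sgraph_scheme \<Rightarrow> 'a set set" where
  "components G = {C. \<exists>u \<in> verts G. C = {v. \<exists>p. path_between G u p v}}"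

definition degree :: "('a, 'b) sgraph_scheme \<Rightarrow> 'a \<Rightarrow> nat" where
  "degree G v = card {e \<in> edges G. v \<in> e}"

text \<open>In a tree the path from \<open>r\<close> to \<open>w\<close> is unique; the subtree rooted at \<open>v\<close> (with respect
  to the root \<open>r\<close>) is spanned by the vertices \<open>w\<close> for which this path visits \<open>v\<close>.\<close>

definition subtree_verts :: "('a, 'b) sgraph_scheme \<Rightarrow> 'a \<Rightarrow> 'a \<Rightarrow> 'a set" where
  "subtree_verts G r v = {w. \<exists>p. path_between G r p w \<and> v \<in> set p}"

definition subtree_edges :: "('a, 'b) sgraph_scheme \<Rightarrow> 'a \<Rightarrow> 'a \<Rightarrow> 'a set set" where
  "subtree_edges G r v = {e \<in> edges G. e \<subseteq> subtree_verts G r v}"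

text \<open>Times are positive, so that every label lies in \<open>{1..lifetime}\<close>; individual edges may
  have no label at all. The values of \<open>labels\<close> outside \<open>edges\<close> are irrelevant.\<close>

record 'a tgraph = "'a sgraph" +
  labels :: "'a set \<Rightarrow> nat set"

definition temporal_graph :: "'a tgraph \<Rightarrow> bool" where
  "temporal_graph \<G> \<longleftrightarrow> simple_graph \<G> \<and>
     (\<forall>e \<in> edges \<G>. finite (labels \<G> e) \<and> 0 \<notin> labels \<G> e)"

definition time_edges :: "'a tgraph \<Rightarrow> ('a set \<times> nat) set" where
  "time_edges \<G> = {(e, t). e \<in> edges \<G> \<and> t \<in> labels \<G> e}"

definition lifetime :: "'a tgraph \<Rightarrow> nat" where
  "lifetime \<G> = Max (snd ` time_edges \<G>)"

definition snapshot :: "'a tgraph \<Rightarrow> nat \<Rightarrow> 'a sgraph" where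
  "snapshot \<G> t = \<lparr>verts = verts \<G>, edges = {e. (e, t) \<in> time_edges \<G>}\<rparr>"

definition graph_ge :: "'a tgraph \<Rightarrow> nat \<Rightarrow> 'a sgraph" where
  "graph_ge \<G> t = \<lparr>verts = verts \<G>, edges = {e. \<exists>t' \<ge> t. (e, t') \<in> time_edges \<G>}\<rparr>"

text \<open>The set \<open>F\<^sub>t\<close> of the VIM sequence. The minimum and maximum are only meaningful for edges
  with at least one label.\<close>

definition vim :: "'a tgraph \<Rightarrow> nat \<Rightarrow> 'a set" where
  "vim \<G> t = {v \<in> verts \<G>. \<exists>u w.
     {v, u} \<in> edges \<G> \<and> labels \<G> {v, u} \<noteq> {} \<and>
     {v, w} \<in> edges \<G> \<and> labels \<G> {v, w} \<noteq> {} \<and>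
     Min (labels \<G> {v, u}) \<le> t \<and> t \<le> Max (labels \<G> {v, w})}"

definition ge_connected_vim_width :: "'a tgraph \<Rightarrow> nat" where
  "ge_connected_vim_width \<G> =
     Max {card (C \<inter> vim \<G> t) | t C. t \<in> {1..lifetime \<G>} \<and> C \<in> components (graph_ge \<G> t)}"

definition fill_gaps :: "'a tgraph \<Rightarrow> 'a tgraph" where
  "fill_gaps \<G> = \<G>\<lparr>labels := (\<lambda>e. labels \<G> e \<union>
     {t. \<exists>t\<^sub>1 t\<^sub>2. t\<^sub>1 < t \<and> t < t\<^sub>2 \<and> (e, t\<^sub>1) \<in> time_edges \<G> \<and> (e, t\<^sub>2) \<in> time_edges \<G>})\<rparr>"

definition incident_edges_first :: "'a tgraph \<Rightarrow> 'a \<Rightarrow> bool" where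
  "incident_edges_first \<G> r \<longleftrightarrow>
     (\<forall>v \<in> verts \<G>. \<forall>e f s t.
        (e, s) \<in> time_edges \<G> \<and> v \<in> e \<and>
        (f, t) \<in> time_edges \<G> \<and> f \<in> subtree_edges \<G> r v \<and> v \<notin> f \<longrightarrow> s < t)"

end

theory Submission
  imports Defs
begin

text \<open>
  Let \<open>x\<close> be the vertex closest to the root in a component \<open>C\<close> of \<open>G\<^sub>\<ge>(t)\<close>. The first edge
  of any nontrivial path in \<open>C\<close> starting at \<open>x\<close> is active at some time \<open>\<ge> t\<close>, hence every label in the subtree
  of \<open>x\<close> on an edge avoiding \<open>x\<close> exceeds \<open>t\<close>. So the only vertices of \<open>C\<close> other than \<open>x\<close> that
  can lie in \<open>F\<^sub>t\<close> are neighbours of \<open>x\<close> in \<open>G'\<^sub>t\<close>, which gives the upper bound. For the lower bound,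
  a vertex together with its neighbours in \<open>G'\<^sub>t\<close> lies in \<open>F\<^sub>t\<close> and in one component of \<open>G\<^sub>\<ge>(t)\<close>.
\<close>

section \<open>Walks, paths and connected components\<close>

lemma walk_append:
  assumes "walk G p" "walk G q" "last p = hd q"
  shows "walk G (p @ tl q)" "hd (p @ tl q) = hd p" "last (p @ tl q) = last q"
proof -
  obtain a q' where q: "q = a # q'" using assms(2) by (cases q) (auto simp: walk_def)
  show "walk G (p @ tl q)"
    using assms unfolding walk_def q
    by (cases q') (auto simp: successively_append_iff)
  show "hd (p @ tl q) = hd p" using assms(1) by (simp add: walk_def)
  show "last (p @ tl q) = last q" using assms(3) q by (cases q') auto
qed

lemma walk_prefix: "walk G (p @ y # q) \<Longrightarrow> walk G (p @ [y])"
  unfolding walk_def by (auto simp: successively_append_iff)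

lemma walk_suffix: "walk G (p @ y # q) \<Longrightarrow> walk G (y # q)"
  unfolding walk_def by (auto simp: successively_append_iff)

lemma walk_rev: "walk G p \<Longrightarrow> walk G (rev p)"
  unfolding walk_def by (auto simp: insert_commute)

lemma walk_edge: "{u, v} \<in> edges G \<Longrightarrow> u \<in> verts G \<Longrightarrow> v \<in> verts G \<Longrightarrow> walk G [u, v]"
  unfolding walk_def by auto

lemma walk_mono:
  assumes "walk G p" "verts G \<subseteq> verts H" "edges G \<subseteq> edges H"
  shows "walk H p"
  using assms unfolding walk_def by (auto elim!: successively_mono)

text \<open>A repeated vertex encloses a closed stretch; cutting it out leaves a shorter walk with
  the same ends, so induction on the length applies.\<close>

lemma path_between_of_walk:
  assumes "walk G p"
  shows "\<exists>q. path_between G (hd p) q (last p)"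
  using assms
proof (induction "length p" arbitrary: p rule: less_induct)
  case less
  show ?case
  proof (cases "distinct p")
    case True
    then show ?thesis using less.prems by (auto simp: path_between_def)
  next
    case False
    then obtain xs ys zs y where p: "p = xs @ [y] @ ys @ [y] @ zs"
      using not_distinct_decomp by blast
    have "walk G (y # zs)"
      using less.prems walk_suffix[of G "xs @ y # ys" y zs] by (simp add: p)
    then have w: "walk G (xs @ y # zs)"
      using less.prems unfolding walk_def p by (auto simp: successively_append_iff)
    have "hd (xs @ y # zs) = hd p" "last (xs @ y # zs) = last p"
      by (auto simp: p hd_append)
    then show ?thesis using less.hyps[OF _ w] by (simp add: p)
  qed
qed

text \<open>Walks, unlike paths, can be concatenated with no check for distinctness, so membership
  in a component is handled through them from here on.\<close>

lemma components_iff_walk: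
  "C \<in> components G \<longleftrightarrow>
     (\<exists>u \<in> verts G. C = {v. \<exists>p. walk G p \<and> hd p = u \<and> last p = v})"
proof -
  have "(\<exists>p. path_between G u p v) \<longleftrightarrow> (\<exists>p. walk G p \<and> hd p = u \<and> last p = v)" for u v
    using path_between_of_walk by (fastforce simp: path_between_def)
  then show ?thesis unfolding components_def by simp
qed

lemma component_walk_closed:
  assumes "C \<in> components G" "walk G p" "hd p \<in> C"
  shows "set p \<subseteq> C"
proof
  fix y assume "y \<in> set p"
  then obtain p1 p2 where p: "p = p1 @ y # p2" by (meson split_list)
  obtain u where "u \<in> verts G" and C: "C = {v. \<exists>p. walk G p \<and> hd p = u \<and> last p = v}"
    using assms(1) unfolding components_iff_walk by (elim bexE)
  obtain q where q: "walk G q" "hd q = u" "last q = hd p" using assms(3) unfolding C by auto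
  have w: "walk G (p1 @ [y])" using assms(2) unfolding p by (rule walk_prefix)
  have "hd (p1 @ [y]) = hd p" using p by (cases p1) auto
  then show "y \<in> C"
    using walk_append[OF q(1) w] q C by (auto intro!: exI[of _ "q @ tl (p1 @ [y])"])
qed

text \<open>Going back from \<open>x\<close> to the base vertex \<open>u\<close> of the component
  and on to \<open>v\<close> gives a walk. It shortens to a path, which cannot leave
  \<open>C\<close>.\<close>

lemma component_path:
  assumes "C \<in> components G" "x \<in> C" "v \<in> C"
  shows "\<exists>q. path_between G x q v \<and> set q \<subseteq> C"
proof -
  obtain u where "u \<in> verts G" and C: "C = {v. \<exists>p. walk G p \<and> hd p = u \<and> last p = v}"
    using assms(1) unfolding components_iff_walk by (elim bexE)
  obtain p where p: "walk G p" "hd p = u" "last p = x" using assms(2) unfolding C by auto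
  obtain q where q: "walk G q" "hd q = u" "last q = v" using assms(3) unfolding C by auto
  have "walk G (rev p)" "hd (rev p) = x" "last (rev p) = u"
    using p walk_rev by (auto simp: walk_def hd_rev last_rev)
  then obtain s where "path_between G x s v"
    using walk_append[of G "rev p" q] q path_between_of_walk by metis
  then show ?thesis
    using component_walk_closed[OF assms(1)] assms(2) by (metis path_between_def)
qed

lemma subset_verts_component: "C \<in> components G \<Longrightarrow> C \<subseteq> verts G"
  unfolding components_def path_between_def walk_def by auto

lemma component_nonempty:
  assumes "C \<in> components G" shows "C \<noteq> {}"
proof -
  obtain u where "u \<in> verts G" "C = {v. \<exists>p. walk G p \<and> hd p = u \<and> last p = v}"
    using assms unfolding components_iff_walk by (elim bexE)
  moreover have "walk G [u]" using \<open>u \<in> verts G\<close> by (simp add: walk_def)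
  ultimately show ?thesis by fastforce
qed

section \<open>Subtrees of a rooted tree\<close>

text \<open>The only way out of the subtree of \<open>x\<close> leads through \<open>x\<close>
  itself. A path from \<open>r\<close> through \<open>x\<close> to \<open>v\<close> is either
  extended by \<open>u\<close> or, if it already contains \<open>u\<close>, cut off at
  \<open>u\<close>.\<close>

lemma subtree_verts_neighbour:
  assumes acyclic: "\<nexists>p. cycle G p"
    and v: "v \<in> subtree_verts G r x" "v \<noteq> x"
    and u: "{v, u} \<in> edges G" "u \<in> verts G" "u \<noteq> v" "u \<noteq> x"
  shows "u \<in> subtree_verts G r x"
proof -
  obtain p where p: "path_between G r p v" "x \<in> set p"
    using v(1) by (auto simp: subtree_verts_def)
  have walk: "walk G p" and dist: "distinct p" and hd: "hd p = r" and last: "last p = v"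
    using p(1) by (auto simp: path_between_def)
  have ne: "p \<noteq> []" using walk by (simp add: walk_def)
  have v_verts: "v \<in> verts G" using walk last ne by (auto simp: walk_def)
  show ?thesis
  proof (cases "u \<in> set p")
    case False
    have "walk G (p @ tl [v, u])"
      using walk_append(1)[OF walk walk_edge[OF u(1) v_verts u(2)]] last by simp
    then have "path_between G r (p @ [u]) u"
      using dist hd ne False by (auto simp: path_between_def)
    then show ?thesis using p(2) by (auto simp: subtree_verts_def)
  next
    case True
    then obtain p1 p2 where split: "p = p1 @ u # p2" by (meson split_list)
    \<comment> \<open>If \<open>x\<close> came after \<open>u\<close>, the stretch from
      \<open>u\<close> via \<open>x\<close> to \<open>v\<close> would be closed to a cycle by the
      edge \<open>{v, u}\<close>; it has at least three vertices because \<open>x\<close> differs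
      from \<open>u\<close> and \<open>v\<close>.\<close>
    have "x \<notin> set p2"
    proof
      assume x: "x \<in> set p2"
      then obtain a b where p2: "p2 = a @ x # b" by (meson split_list)
      have "b \<noteq> []" using last v(2) split p2 by auto
      have "walk G (u # p2)" using walk unfolding split by (rule walk_suffix)
      moreover have "3 \<le> length (u # p2)" using p2 \<open>b \<noteq> []\<close> by (cases b) auto
      moreover have "last (u # p2) = v" using last split by auto
      ultimately have "cycle G (u # p2)"
        using dist split u(1) by (auto simp: cycle_def)
      then show False using acyclic by blast
    qed
    then have "x \<in> set p1" using p(2) split u(4) by auto
    moreover have "path_between G r (p1 @ [u]) u"
      using walk_prefix[of G p1 u p2] walk dist hd split
      by (cases p1) (auto simp: path_between_def)
    ultimately show ?thesis by (auto simp: subtree_verts_def)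
  qed
qed

text \<open>A shortest path from \<open>r\<close> to any vertex of \<open>C\<close> meets
  \<open>C\<close> only at its end \<open>x\<close>. It can therefore be prolonged by a path inside
  \<open>C\<close> from \<open>x\<close> to any other vertex of \<open>C\<close>, and the result
  still passes through \<open>x\<close>.\<close>

lemma component_top:
  assumes tree: "tree G" and r: "r \<in> verts G"
    and H: "verts H = verts G" "edges H \<subseteq> edges G" and C: "C \<in> components H"
  shows "\<exists>x \<in> C. C \<subseteq> subtree_verts G r x"
proof -
  let ?P = "\<lambda>p. \<exists>w \<in> C. path_between G r p w"
  obtain w where "w \<in> C" using component_nonempty[OF C] by blast
  moreover from this have "w \<in> verts G" using subset_verts_component[OF C] H by auto
  ultimately have "\<exists>p. ?P p"
    using tree r by (metis tree_def connected_graph_def)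
  then obtain p where "?P p" and least: "\<And>q. ?P q \<Longrightarrow> length p \<le> length q"
    using ex_has_least_nat[of ?P _ length] by metis
  then obtain x where x: "x \<in> C" "path_between G r p x" by blast
  have p: "walk G p" "distinct p" "hd p = r" "last p = x"
    using x(2) by (auto simp: path_between_def)
  \<comment> \<open>Cutting \<open>p\<close> at an earlier vertex of \<open>C\<close> would
    contradict minimality.\<close>
  have only_x: "y = x" if y: "y \<in> set p" "y \<in> C" for y
  proof (rule ccontr)
    assume "y \<noteq> x"
    obtain p1 p2 where split: "p = p1 @ y # p2" using y(1) by (meson split_list)
    have "path_between G r (p1 @ [y]) y"
      using walk_prefix[of G p1 y p2] p split by (cases p1) (auto simp: path_between_def)
    then have "length p \<le> length (p1 @ [y])" using least y(2) by blast
    then have "p2 = []" using split by simp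
    then show False using \<open>y \<noteq> x\<close> p(4) split by simp
  qed
  have "v \<in> subtree_verts G r x" if v: "v \<in> C" for v
  proof -
    obtain q where q: "path_between H x q v" "set q \<subseteq> C"
      using component_path[OF C x(1) v] by blast
    have wq: "walk G q" using q(1) H walk_mono[of H q G] by (auto simp: path_between_def)
    have q': "hd q = x" "last q = v" "distinct q" using q(1) by (auto simp: path_between_def)
    obtain q2 where q2: "q = x # q2" using q'(1) wq by (cases q) (auto simp: walk_def)
    have "set p \<inter> set (tl q) = {}" using only_x q(2) q'(3) q2 by auto
    then have "path_between G r (p @ tl q) v"
      using walk_append[OF p(1) wq] p q' distinct_tl by (auto simp: path_between_def)
    moreover have "x \<in> set (p @ tl q)" using p by (auto simp: walk_def)
    ultimately show ?thesis unfolding subtree_verts_def by blast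
  qed
  then show ?thesis using x(1) by blast
qed

section \<open>Degrees, filled gaps and VIM sets\<close>

lemma finite_edges: "simple_graph G \<Longrightarrow> finite (edges G)"
  by (rule finite_subset[of _ "Pow (verts G)"]) (auto simp: simple_graph_def)

lemma simple_graph_edge:
  assumes "simple_graph G" "{u, v} \<in> edges G"
  shows "u \<noteq> v" "u \<in> verts G" "v \<in> verts G"
  using assms unfolding simple_graph_def by (metis doubleton_eq_iff)+

lemma degree_eq_card_neighbours:
  assumes "simple_graph G"
  shows "degree G x = card {y. {x, y} \<in> edges G}"
proof -
  have "bij_betw (\<lambda>y. {x, y}) {y. {x, y} \<in> edges G} {e \<in> edges G. x \<in> e}"
    unfolding bij_betw_def
  proof
    show "inj_on (\<lambda>y. {x, y}) {y. {x, y} \<in> edges G}"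
      by (rule inj_onI) (metis doubleton_eq_iff)
    have "\<exists>y. e = {x, y}" if "e \<in> edges G" "x \<in> e" for e
      using that assms unfolding simple_graph_def by (metis insertE insert_commute singletonD)
    then show "(\<lambda>y. {x, y}) ` {y. {x, y} \<in> edges G} = {e \<in> edges G. x \<in> e}"
      by auto
  qed
  then show ?thesis unfolding degree_def by (simp add: bij_betw_same_card)
qed

lemma finite_neighbours:
  assumes "simple_graph G" shows "finite {y. {x, y} \<in> edges G}"
  using finite_subset[of "{y. {x, y} \<in> edges G}" "verts G"] simple_graph_edge(3)[OF assms] assms
  by (auto simp: simple_graph_def)

lemma finite_time_edges:
  assumes "temporal_graph \<G>" shows "finite (time_edges \<G>)"
proof -
  have "time_edges \<G> = Sigma (edges \<G>) (labels \<G>)" by (auto simp: time_edges_def)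
  then show ?thesis using assms finite_edges by (auto simp: temporal_graph_def)
qed

text \<open>The weak inequalities cover both cases at once: equality on either side gives an
  original label, two strict ones give a filled gap.\<close>

lemma time_edges_fill_gaps:
  "(e, t) \<in> time_edges (fill_gaps \<G>) \<longleftrightarrow>
     (\<exists>t1 \<le> t. \<exists>t2 \<ge> t. (e, t1) \<in> time_edges \<G> \<and> (e, t2) \<in> time_edges \<G>)"
proof
  show "\<exists>t1 \<le> t. \<exists>t2 \<ge> t. (e, t1) \<in> time_edges \<G> \<and> (e, t2) \<in> time_edges \<G>"
    if "(e, t) \<in> time_edges (fill_gaps \<G>)"
    using that by (auto simp: time_edges_def fill_gaps_def intro: less_imp_le)
  show "(e, t) \<in> time_edges (fill_gaps \<G>)"
    if "\<exists>t1 \<le> t. \<exists>t2 \<ge> t. (e, t1) \<in> time_edges \<G> \<and> (e, t2) \<in> time_edges \<G>"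
    using that by (auto simp: time_edges_def fill_gaps_def order_le_less)
qed

lemma simple_snapshot_fill_gaps:
  "simple_graph \<G> \<Longrightarrow> simple_graph (snapshot (fill_gaps \<G>) t)"
  by (auto simp: simple_graph_def snapshot_def time_edges_def fill_gaps_def)

text \<open>Each added label lies below an original one, so the maximum does not change.\<close>

lemma lifetime_fill_gaps:
  assumes tg: "temporal_graph \<G>" and ne: "time_edges \<G> \<noteq> {}"
  shows "lifetime (fill_gaps \<G>) = lifetime \<G>"
  unfolding lifetime_def
proof (rule Max_eqI)
  have fin: "finite (snd ` time_edges \<G>)" using finite_time_edges[OF tg] by blast
  show le: "t \<le> Max (snd ` time_edges \<G>)" if t: "t \<in> snd ` time_edges (fill_gaps \<G>)" for t
  proof -
    obtain e t2 where "t2 \<ge> t" "(e, t2) \<in> time_edges \<G>"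
      using t by (auto simp: time_edges_fill_gaps)
    then show ?thesis using Max_ge[OF fin, of t2] by force
  qed
  then show "finite (snd ` time_edges (fill_gaps \<G>))"
    by (meson finite_nat_set_iff_bounded_le)
  have "time_edges \<G> \<subseteq> time_edges (fill_gaps \<G>)"
    by (auto simp: time_edges_def fill_gaps_def)
  moreover have "Max (snd ` time_edges \<G>) \<in> snd ` time_edges \<G>"
    using Max_in[OF fin] ne by blast
  ultimately show "Max (snd ` time_edges \<G>) \<in> snd ` time_edges (fill_gaps \<G>)"
    by blast
qed

lemma time_edge_le_lifetime:
  assumes "temporal_graph \<G>" "(e, t) \<in> time_edges \<G>"
  shows "t \<in> {1..lifetime \<G>}"
proof -
  have "t \<noteq> 0" using assms by (cases t) (auto simp: temporal_graph_def time_edges_def)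
  moreover have "t \<le> lifetime \<G>"
    unfolding lifetime_def using assms finite_time_edges by (intro Max_ge) force+
  ultimately show ?thesis by auto
qed

text \<open>Label sets are finite, so bounds on \<open>Min\<close> and \<open>Max\<close> amount to
  the existence of labels on the respective side of \<open>t\<close>.\<close>

lemma vim_iff:
  assumes tg: "temporal_graph \<G>"
  shows "v \<in> vim \<G> t \<longleftrightarrow>
    (\<exists>u w. \<exists>t1 \<le> t. \<exists>t2 \<ge> t. ({v, u}, t1) \<in> time_edges \<G> \<and> ({v, w}, t2) \<in> time_edges \<G>)"
    (is "_ \<longleftrightarrow> ?R")
proof
  have fin: "finite (labels \<G> e)" if "e \<in> edges \<G>" for e
    using tg that by (simp add: temporal_graph_def)
  show ?R if v: "v \<in> vim \<G> t"
  proof -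
    obtain u w where uw: "{v, u} \<in> edges \<G>" "labels \<G> {v, u} \<noteq> {}"
        "{v, w} \<in> edges \<G>" "labels \<G> {v, w} \<noteq> {}"
        "Min (labels \<G> {v, u}) \<le> t" "t \<le> Max (labels \<G> {v, w})"
      using v unfolding vim_def by blast
    have "({v, u}, Min (labels \<G> {v, u})) \<in> time_edges \<G>"
         "({v, w}, Max (labels \<G> {v, w})) \<in> time_edges \<G>"
      using uw Min_in[OF fin] Max_in[OF fin] by (auto simp: time_edges_def)
    then show ?R using uw(5,6) by blast
  qed
  show "v \<in> vim \<G> t" if rhs: ?R
  proof -
    obtain u w t1 t2 where uw: "t1 \<le> t" "t2 \<ge> t"
        "{v, u} \<in> edges \<G>" "t1 \<in> labels \<G> {v, u}" "{v, w} \<in> edges \<G>" "t2 \<in> labels \<G> {v, w}"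
      using rhs unfolding time_edges_def by auto
    have "Min (labels \<G> {v, u}) \<le> t" "t \<le> Max (labels \<G> {v, w})"
      using uw Min_le[OF fin] Max_ge[OF fin] by (meson order_trans)+
    moreover have "v \<in> verts \<G>"
      using uw(3) tg by (auto simp: temporal_graph_def dest: simple_graph_edge(2))
    ultimately show ?thesis using uw unfolding vim_def by blast
  qed
qed

section \<open>Components against closed neighbourhoods\<close>

text \<open>With \<open>x\<close> the top of \<open>C\<close>, the ordering assumption at
  \<open>x\<close> governs every edge that leaves a vertex \<open>v\<close> of \<open>C\<close> and
  avoids \<open>x\<close>. A label at most \<open>t\<close> at \<open>v\<close> can then only sit on
  the edge \<open>{v, x}\<close>.\<close>

lemma component_vim_subset:
  assumes tg: "temporal_graph \<G>" and tree: "tree \<G>"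
    and r: "r \<in> verts \<G>" and inc: "incident_edges_first \<G> r"
    and C: "C \<in> components (graph_ge \<G> t)"
  shows "\<exists>x \<in> C. C \<inter> vim \<G> t \<subseteq> insert x {y. {x, y} \<in> edges (snapshot (fill_gaps \<G>) t)}"
proof -
  let ?H = "graph_ge \<G> t"
  have H: "verts ?H = verts \<G>" "edges ?H \<subseteq> edges \<G>"
    by (auto simp: graph_ge_def time_edges_def)
  have simple: "simple_graph \<G>" and acyclic: "\<nexists>p. cycle \<G> p"
    using tree by (auto simp: tree_def)
  obtain x where x: "x \<in> C" "C \<subseteq> subtree_verts \<G> r x"
    using component_top[OF tree r H C] by blast
  have xv: "x \<in> verts \<G>" using subset_verts_component[OF C] x(1) H(1) by auto
  have "{x, v} \<in> edges (snapshot (fill_gaps \<G>) t)"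
    if v: "v \<in> C" "v \<in> vim \<G> t" "v \<noteq> x" for v
  proof -
    obtain q where q: "path_between ?H x q v" using component_path[OF C x(1) v(1)] by blast
    then obtain y q2 where q2: "q = x # y # q2"
      using v(3) by (cases q; cases "tl q") (auto simp: path_between_def walk_def)
    have "{x, y} \<in> edges ?H" using q q2 by (simp add: path_between_def walk_def)
    then obtain s where s: "s \<ge> t" "({x, y}, s) \<in> time_edges \<G>" by (auto simp: graph_ge_def)
    obtain u t1 where u: "t1 \<le> t" "({v, u}, t1) \<in> time_edges \<G>"
      using v(2) vim_iff[OF tg] by blast
    have e: "{v, u} \<in> edges \<G>" using u(2) by (simp add: time_edges_def)
    note vu = simple_graph_edge[OF simple e]
    \<comment> \<open>Otherwise \<open>{v, u}\<close> lies in the subtree of \<open>x\<close> and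
      avoids \<open>x\<close>, which forces \<open>s < t1\<close>, against
      \<open>t1 \<le> t \<le> s\<close>.\<close>
    have "u = x"
    proof (rule ccontr)
      assume "u \<noteq> x"
      then have "u \<in> subtree_verts \<G> r x"
        using subtree_verts_neighbour[OF acyclic, of v r x u] x(2) v vu e by auto
      then have "{v, u} \<in> subtree_edges \<G> r x"
        using e x(2) v(1) by (auto simp: subtree_edges_def)
      moreover have "x \<notin> {v, u}" using \<open>u \<noteq> x\<close> v(3) by auto
      ultimately have "s < t1"
        using inc xv s(2) u(2) unfolding incident_edges_first_def by blast
      then show False using s(1) u(1) by simp
    qed
    \<comment> \<open>The edge \<open>{v, x}\<close> would close a longer \<open>q\<close> to a
      cycle. Hence \<open>y = v\<close>, and the labels \<open>t1\<close> and \<open>s\<close> on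
      the two sides of \<open>t\<close> belong to the same edge.\<close>
    have "q2 = []"
    proof (rule ccontr)
      assume "q2 \<noteq> []"
      then have "3 \<le> length q" using q2 by (cases q2) auto
      moreover have "walk \<G> q" using q H walk_mono[of ?H q \<G>] by (auto simp: path_between_def)
      ultimately have "cycle \<G> q"
        using q e \<open>u = x\<close> by (simp add: cycle_def path_between_def)
      then show False using acyclic by blast
    qed
    then have "y = v" using q q2 by (simp add: path_between_def)
    moreover have "({x, v}, t1) \<in> time_edges \<G>"
      using u(2) \<open>u = x\<close> by (simp add: insert_commute)
    ultimately have "({x, v}, t) \<in> time_edges (fill_gaps \<G>)"
      using s u(1) unfolding time_edges_fill_gaps by blast
    then show ?thesis by (simp add: snapshot_def)
  qed
  then show ?thesis using x(1) by auto
qed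

text \<open>An edge of the filled snapshot has original labels on both sides of \<open>t\<close>:
  together they put its ends into \<open>vim \<G> t\<close>, and the later one makes it an edge of
  \<open>graph_ge \<G> t\<close>. Nonemptiness of \<open>N\<close> is what places \<open>x\<close>
  itself in \<open>vim \<G> t\<close>.\<close>

lemma closed_neighbourhood_in_component:
  assumes tg: "temporal_graph \<G>"
    and N: "N = {y. {x, y} \<in> edges (snapshot (fill_gaps \<G>) t)}" "N \<noteq> {}"
  shows "\<exists>C \<in> components (graph_ge \<G> t). insert x N \<subseteq> C \<inter> vim \<G> t"
proof -
  let ?H = "graph_ge \<G> t"
  have N': "y \<in> N \<longleftrightarrow> (\<exists>t1 \<le> t. \<exists>t2 \<ge> t. ({x, y}, t1) \<in> time_edges \<G> \<and> ({x, y}, t2) \<in> time_edges \<G>)"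
    for y by (simp add: N(1) snapshot_def time_edges_fill_gaps)
  have in_vim: "x \<in> vim \<G> t" "N \<subseteq> vim \<G> t"
    using N(2) N' by (fastforce simp: vim_iff[OF tg] insert_commute)+
  then have xv: "x \<in> verts \<G>" by (simp add: vim_def)
  define C where "C = {v. \<exists>p. walk ?H p \<and> hd p = x \<and> last p = v}"
  have "C \<in> components ?H" using xv by (auto simp: C_def components_iff_walk graph_ge_def)
  moreover have "x \<in> C" using xv by (auto simp: C_def walk_def graph_ge_def intro!: exI[of _ "[x]"])
  moreover have "y \<in> C" if "y \<in> N" for y
  proof -
    have "{x, y} \<in> edges ?H" using that N' by (auto simp: graph_ge_def)
    moreover have "y \<in> verts \<G>" using that in_vim by (auto simp: vim_def)
    ultimately have "walk ?H [x, y]" using xv by (intro walk_edge) (auto simp: graph_ge_def)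
    then show ?thesis unfolding C_def by fastforce
  qed
  ultimately show ?thesis using in_vim by (intro bexI[of _ C]) auto
qed

theorem mainTheorem14:
  fixes \<G> :: "'a tgraph"
  assumes "temporal_graph \<G>"
    and "tree \<G>"
    and "time_edges \<G> \<noteq> {}"
    and "\<exists>r \<in> verts \<G>. incident_edges_first \<G> r"
  shows "ge_connected_vim_width \<G> =
    Max ((\<lambda>t. Max ((\<lambda>v. degree (snapshot (fill_gaps \<G>) t) v) ` verts \<G>))
          ` {1..lifetime (fill_gaps \<G>)}) + 1"
proof -
  obtain r where r: "r \<in> verts \<G>" "incident_edges_first \<G> r" using assms(4) by blast
  have simple: "simple_graph \<G>" using assms(2) by (simp add: tree_def)
  have fin: "finite (verts \<G>)" using simple by (simp add: simple_graph_def)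
  define N where "N t x = {y. {x, y} \<in> edges (snapshot (fill_gaps \<G>) t)}" for t x
  have finN: "finite (N t x)" for t x
    unfolding N_def by (rule finite_neighbours[OF simple_snapshot_fill_gaps[OF simple]])
  have notin: "x \<notin> N t x" for t x
    using simple_graph_edge(1)[OF simple_snapshot_fill_gaps[OF simple]] unfolding N_def by blast
  have degree: "degree (snapshot (fill_gaps \<G>) t) x = card (N t x)" for t x
    unfolding N_def by (rule degree_eq_card_neighbours[OF simple_snapshot_fill_gaps[OF simple]])
  define T where "T = {1..lifetime \<G>}"
  define D where "D t = Max ((\<lambda>v. card (N t v)) ` verts \<G>)" for t
  define S where "S = {card (C \<inter> vim \<G> t) | t C. t \<in> T \<and> C \<in> components (graph_ge \<G> t)}"
  \<comment> \<open>This time-edge shows that \<open>T\<close> is nonempty, so that the maximum over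
    \<open>T\<close> is attained, and later that this maximum is positive.\<close>
  obtain e0 t0 where e0: "(e0, t0) \<in> time_edges \<G>" using assms(3) by auto
  then have t0: "t0 \<in> T" unfolding T_def by (rule time_edge_le_lifetime[OF assms(1)])
  obtain a b where ab: "e0 = {a, b}" "a \<in> verts \<G>"
    using e0 simple by (auto simp: time_edges_def simple_graph_def)
  have finT: "finite T" by (simp add: T_def)
  have card_le: "card (N t x) \<le> Max (D ` T)" if "t \<in> T" "x \<in> verts \<G>" for t x
  proof -
    have "card (N t x) \<le> D t" unfolding D_def using that fin by (intro Max_ge) auto
    also have "\<dots> \<le> Max (D ` T)" using that finT by (intro Max_ge) auto
    finally show ?thesis .
  qed
  have upper: "s \<le> Max (D ` T) + 1" if s: "s \<in> S" for s
  proof -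
    obtain t C where tC: "s = card (C \<inter> vim \<G> t)" "t \<in> T" "C \<in> components (graph_ge \<G> t)"
      using s S_def by blast
    obtain x where x: "x \<in> C" "C \<inter> vim \<G> t \<subseteq> insert x (N t x)"
      using component_vim_subset[OF assms(1,2) r tC(3)] unfolding N_def by blast
    have xv: "x \<in> verts \<G>"
      using subset_verts_component[OF tC(3)] x(1) by (auto simp: graph_ge_def)
    have "s \<le> card (insert x (N t x))" using x(2) finN tC(1) by (simp add: card_mono)
    also have "\<dots> = card (N t x) + 1" using finN notin by simp
    also have "\<dots> \<le> Max (D ` T) + 1" using card_le[OF tC(2) xv] by simp
    finally show ?thesis .
  qed
  \<comment> \<open>The upper bound makes \<open>S\<close> a bounded set of naturals, which
    justifies the use of \<open>Max S\<close>.\<close>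
  have finS: "finite S" using upper by (meson finite_nat_set_iff_bounded_le)
  obtain t where t: "t \<in> T" "Max (D ` T) = D t"
    using Max_in[of "D ` T"] t0 finT by (metis empty_iff finite_imageI imageE image_is_empty)
  obtain x where x: "x \<in> verts \<G>" "D t = card (N t x)"
    using Max_in[of "(\<lambda>v. card (N t v)) ` verts \<G>"] fin ab(2) unfolding D_def
    by (metis empty_iff finite_imageI imageE image_is_empty)
  \<comment> \<open>A positive degree at time \<open>t0\<close> makes the maximal degree positive,
    so the maximising neighbourhood \<open>N t x\<close> is nonempty, as the lower bound
    requires.\<close>
  have "b \<in> N t0 a"
    using e0 ab(1) by (auto simp: N_def snapshot_def time_edges_fill_gaps)
  then have "card (N t0 a) > 0" using finN card_gt_0_iff by blast
  then have "N t x \<noteq> {}" using card_le[OF t0 ab(2)] t(2) x(2) by auto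
  then obtain C where C: "C \<in> components (graph_ge \<G> t)" "insert x (N t x) \<subseteq> C \<inter> vim \<G> t"
    using closed_neighbourhood_in_component[OF assms(1), of "N t x" x t] N_def by blast
  have "finite (C \<inter> vim \<G> t)" using fin by (simp add: vim_def)
  then have "card (insert x (N t x)) \<le> card (C \<inter> vim \<G> t)" using C(2) by (rule card_mono)
  \<comment> \<open>The summand 1 counts \<open>x\<close>, which is not its own neighbour.\<close>
  moreover have "card (insert x (N t x)) = Max (D ` T) + 1" using finN notin t(2) x(2) by simp
  moreover have mem: "card (C \<inter> vim \<G> t) \<in> S" using t(1) C(1) S_def by blast
  ultimately have "Max (D ` T) + 1 \<le> Max S" using Max_ge[OF finS mem] by linarith
  moreover have "Max S \<le> Max (D ` T) + 1" using upper finS mem by (subst Max_le_iff) auto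
  ultimately have "Max S = Max (D ` T) + 1" by simp
  then show ?thesis
    unfolding ge_connected_vim_width_def lifetime_fill_gaps[OF assms(1,3)] degree
    unfolding S_def D_def T_def .
qed

end
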